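(* Suppose $n$ is an odd positive integer, $p\equiv 1 \pmod{4}$ is a prime number, $x$ is a positive integer, and $a=px^{2}$. Then $a^{n}+1$ is the sum of two squares if and only if $a^{np}+1$ is the sum of two squares.
   Context: An integer $N$ is "the sum of two squares" if $N = s^2+t^2$ for some integers $s,t$ (zero is allowed). *)

theory Defs
  imports "HOL-Number_Theory.Number_Theory"
begin

definition sum_of_two_squares :: "int \<Rightarrow> bool" where
  "sum_of_two_squares N \<longleftrightarrow> (\<exists>s t :: int. N = s\<^sup>2 + t\<^sup>2)"

end

theory Submission
  imports Defs "HOL-Library.Discrete_Functions"
begin

text \<open>
  Put \<open>b = a ^ n\<close>. Since \<open>n\<close> is odd, \<open>b = p * y\<^sup>2\<close> is again \<open>p\<close> times a square, and
  \<open>a ^ (n * p) + 1 = (b + 1) * Q\<close> with \<open>Q = (\<Sum>i<p. (- b) ^ i)\<close>. The theorem holds because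
  every prime factor \<open>q\<close> of \<open>Q\<close> is a sum of two squares: multiplying by such a prime neither
  creates nor destroys representability as a sum of two squares
  (\<open>sum_of_two_squares_prime_mult_iff\<close>), so the cofactor \<open>Q\<close> can be stripped off one prime
  at a time.

  Clearly \<open>2 = 1 + 1\<close>. Let \<open>q\<close> be an odd prime factor of \<open>Q\<close>. Then \<open>- b\<close> is a \<open>p\<close>-th root of unity modulo \<open>q\<close>.
  It is not \<open>1\<close>, as otherwise \<open>Q \<equiv> p\<close>, so \<open>q = p\<close>; but \<open>Q \<equiv> 1\<close> modulo \<open>p\<close> because \<open>p\<close> divides \<open>b\<close>.
  So \<open>- b\<close> has order \<open>p\<close>, and two things follow. Having odd order, \<open>- b = - p * y\<^sup>2\<close> is a
  square modulo \<open>q\<close>. And \<open>p\<close> divides \<open>q - 1\<close>, so \<open>q\<close> is a square modulo \<open>p\<close>, and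
  quadratic reciprocity with \<open>p \<equiv> 1\<close> modulo \<open>4\<close> makes \<open>p\<close> a square modulo \<open>q\<close>.
  Together, \<open>q\<close> divides a sum of two squares that are not divisible by \<open>q\<close>, and
  Thue's pigeonhole argument shows that \<open>q\<close> itself is a sum of two squares.
\<close>

section \<open>Primes that are sums of two squares\<close>

lemma sum_of_two_squaresI: "N = s\<^sup>2 + t\<^sup>2 \<Longrightarrow> sum_of_two_squares N"
  unfolding sum_of_two_squares_def by blast

text \<open>
  Thue's lemma for the congruence \<open>t * u \<equiv> s * v\<close>: there are more than \<open>m\<close> pairs with entries
  between \<open>0\<close> and \<open>\<lfloor>\<surd>m\<rfloor>\<close>, so two of them give the same residue of \<open>t * u - s * v\<close>, and their
  difference is a small nontrivial solution.
\<close>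

lemma small_solution_linear_cong:
  fixes m :: nat and s t :: int
  assumes "m > 0"
  obtains u v :: int where "(u, v) \<noteq> (0, 0)" "u\<^sup>2 \<le> int ((floor_sqrt m)\<^sup>2)"
    "v\<^sup>2 \<le> int ((floor_sqrt m)\<^sup>2)" "int m dvd t * u - s * v"
proof -
  define k where "k = floor_sqrt m"
  define S where "S = {0..int k} \<times> {0..int k}"
  define f where "f = (\<lambda>(u, v). (t * u - s * v) mod int m)"
  have "f ` S \<subseteq> {0..<int m}"
    using assms by (auto simp: f_def)
  then have "card (f ` S) \<le> card {0..<int m}"
    by (intro card_mono) auto
  also have "\<dots> < (Suc k)\<^sup>2"
    using Suc_floor_sqrt_power2_gt[of m] by (simp add: k_def)
  also have "\<dots> = card S"
    by (simp add: S_def card_cartesian_product power2_eq_square nat_add_distrib)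
  finally have "\<not> inj_on f S"
    by (rule pigeonhole)
  then obtain u1 v1 u2 v2 where *: "(u1, v1) \<in> S" "(u2, v2) \<in> S" "(u1, v1) \<noteq> (u2, v2)"
    "f (u1, v1) = f (u2, v2)"
    unfolding inj_on_def by auto
  have le: "(d - e)\<^sup>2 \<le> int (k\<^sup>2)" if "d \<in> {0..int k}" "e \<in> {0..int k}" for d e
    using that abs_le_square_iff[of "d - e" "int k"] by auto
  show thesis
  proof (rule that[of "u1 - u2" "v1 - v2"])
    have "int m dvd (t * u1 - s * v1) - (t * u2 - s * v2)"
      using *(4) by (simp add: f_def mod_eq_dvd_iff)
    then show "int m dvd t * (u1 - u2) - s * (v1 - v2)"
      by (simp add: algebra_simps)
  qed (use * le in \<open>auto simp: S_def k_def\<close>)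
qed

text \<open>
  A small solution of \<open>t * u \<equiv> s * v\<close> satisfies \<open>t\<^sup>2 * (u\<^sup>2 + v\<^sup>2) \<equiv> v\<^sup>2 * (s\<^sup>2 + t\<^sup>2) \<equiv> 0\<close>, and
  \<open>u\<^sup>2 + v\<^sup>2\<close> is a multiple of \<open>q\<close> strictly between \<open>0\<close> and \<open>2 * q\<close>. Allowing a general \<open>s\<^sup>2 + t\<^sup>2\<close>
  instead of \<open>s\<^sup>2 + 1\<close> avoids inverting \<open>t\<close> modulo \<open>q\<close>.
\<close>

lemma sum_of_two_squares_prime_dvd:
  fixes q :: nat and s t :: int
  assumes q: "prime q" and dvd: "int q dvd s\<^sup>2 + t\<^sup>2" and t: "\<not> int q dvd t"
  shows "sum_of_two_squares (int q)"
proof -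
  have q0: "q > 0" using q prime_gt_0_nat by blast
  obtain u v :: int where uv: "(u, v) \<noteq> (0, 0)" "u\<^sup>2 \<le> int ((floor_sqrt q)\<^sup>2)"
    "v\<^sup>2 \<le> int ((floor_sqrt q)\<^sup>2)" "int q dvd t * u - s * v"
    using small_solution_linear_cong[OF q0] by blast
  have "(floor_sqrt q)\<^sup>2 \<noteq> q"
    using q prime_power_iff[of "floor_sqrt q" 2] by auto
  then have "(floor_sqrt q)\<^sup>2 < q"
    using floor_sqrt_power2_le[of q] by linarith
  then have lt: "u\<^sup>2 + v\<^sup>2 < 2 * int q"
    using uv by linarith
  have pos: "u\<^sup>2 + v\<^sup>2 > 0"
    using uv(1) sum_power2_gt_zero_iff[of u v] by auto
  have "t\<^sup>2 * (u\<^sup>2 + v\<^sup>2) = (t * u - s * v) * (t * u + s * v) + v\<^sup>2 * (s\<^sup>2 + t\<^sup>2)"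
    by (simp add: algebra_simps power2_eq_square)
  then have "int q dvd t\<^sup>2 * (u\<^sup>2 + v\<^sup>2)"
    using uv(4) dvd by (metis dvd_add dvd_mult dvd_mult2)
  moreover have "prime (int q)" using q by simp
  ultimately have "int q dvd u\<^sup>2 + v\<^sup>2"
    using t by (meson prime_dvd_mult_iff prime_dvd_power)
  then obtain j where j: "u\<^sup>2 + v\<^sup>2 = int q * j" by blast
  have "0 < j" using j pos q0 by (simp add: zero_less_mult_iff)
  moreover have "j < 2"
  proof -
    have "int q * j < int q * 2" using j lt by simp
    then show ?thesis using q0 by (simp add: mult_less_cancel_left_pos)
  qed
  ultimately have "j = 1" by linarith
  then have "int q = u\<^sup>2 + v\<^sup>2" using j by simp
  then show ?thesis by (rule sum_of_two_squaresI)
qed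

section \<open>Cancelling prime factors that are sums of two squares\<close>

text \<open>
  With \<open>q = c\<^sup>2 + d\<^sup>2\<close> and \<open>q * m = s\<^sup>2 + t\<^sup>2\<close>, this is division of the Gaussian integer \<open>s + t * \<i>\<close> by
  \<open>c + d * \<i>\<close> or by its conjugate: primality of \<open>q\<close> decides which of the two quotients is integral.
\<close>

lemma sum_of_two_squares_prime_mult_iff:
  fixes q :: nat and m :: int
  assumes q: "prime q" and sq: "sum_of_two_squares (int q)"
  shows "sum_of_two_squares (int q * m) \<longleftrightarrow> sum_of_two_squares m"
proof
  assume "sum_of_two_squares m"
  then obtain s t where m: "m = s\<^sup>2 + t\<^sup>2" unfolding sum_of_two_squares_def by blast
  obtain c d where qcd: "int q = c\<^sup>2 + d\<^sup>2" using sq unfolding sum_of_two_squares_def by blast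
  have "int q * m = (c * s - d * t)\<^sup>2 + (c * t + d * s)\<^sup>2"
    unfolding m qcd by (simp add: algebra_simps power2_eq_square)
  then show "sum_of_two_squares (int q * m)" by (rule sum_of_two_squaresI)
next
  assume "sum_of_two_squares (int q * m)"
  then obtain s t where m: "int q * m = s\<^sup>2 + t\<^sup>2" unfolding sum_of_two_squares_def by blast
  obtain c d where qcd: "int q = c\<^sup>2 + d\<^sup>2" using sq unfolding sum_of_two_squares_def by blast
  have q0: "int q \<noteq> 0" and pq: "prime (int q)" using q by auto
  have divide: "sum_of_two_squares m" if e: "int q = c\<^sup>2 + e\<^sup>2" "int q dvd s * c + t * e" for e
  proof -
    have id: "(s * c + t * e)\<^sup>2 + (t * c - s * e)\<^sup>2 = int q * (int q * m)"
      by (subst m, subst e(1)) (simp add: algebra_simps power2_eq_square)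
    have "int q dvd (s * c + t * e)\<^sup>2" using e(2) by (simp add: power2_eq_square)
    moreover have "int q dvd (s * c + t * e)\<^sup>2 + (t * c - s * e)\<^sup>2" unfolding id by simp
    ultimately have "int q dvd (t * c - s * e)\<^sup>2" using dvd_add_right_iff by blast
    then have "int q dvd t * c - s * e" using pq prime_dvd_power by blast
    then obtain w where w: "t * c - s * e = int q * w" by blast
    obtain z where z: "s * c + t * e = int q * z" using e(2) by blast
    have "int q * (int q * m) = int q * (int q * (z\<^sup>2 + w\<^sup>2))"
      using id unfolding w z by (simp add: algebra_simps power2_eq_square)
    then have "m = z\<^sup>2 + w\<^sup>2" using q0 by simp
    then show ?thesis by (rule sum_of_two_squaresI)
  qed
  have "(s * c + t * d) * (s * c + t * (- d)) = (c\<^sup>2 + d\<^sup>2) * s\<^sup>2 - d\<^sup>2 * (s\<^sup>2 + t\<^sup>2)"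
    by (simp add: algebra_simps power2_eq_square)
  also have "\<dots> = int q * (s\<^sup>2 - d\<^sup>2 * m)"
    by (simp flip: m qcd add: algebra_simps)
  finally have "int q dvd (s * c + t * d) * (s * c + t * (- d))" by simp
  then have "int q dvd s * c + t * d \<or> int q dvd s * c + t * (- d)"
    using pq prime_dvd_mult_iff by blast
  then show "sum_of_two_squares m"
    using divide[of d] divide[of "- d"] qcd by auto
qed

lemma sum_of_two_squares_mult_iff:
  fixes Q :: nat and m :: int
  assumes "Q > 0" and "\<And>q. prime q \<Longrightarrow> q dvd Q \<Longrightarrow> sum_of_two_squares (int q)"
  shows "sum_of_two_squares (int Q * m) \<longleftrightarrow> sum_of_two_squares m"
  using assms
proof (induction Q rule: prime_divisors_induct)
  case (factor q Q)
  have "sum_of_two_squares (int (q * Q) * m) \<longleftrightarrow> sum_of_two_squares (int q * (int Q * m))"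
    by (simp add: mult.assoc)
  also have "\<dots> \<longleftrightarrow> sum_of_two_squares (int Q * m)"
    using factor by (intro sum_of_two_squares_prime_mult_iff) auto
  also have "\<dots> \<longleftrightarrow> sum_of_two_squares m"
    using factor by (intro factor.IH) auto
  finally show ?case .
qed auto

section \<open>Prime factors of the cofactor\<close>

text \<open>
  The order of a \<open>p\<close>-th root of unity other than \<open>1\<close> is exactly \<open>p\<close>, and it divides \<open>q - 1\<close> by
  Fermat's little theorem.
\<close>

lemma prime_dvd_pred_of_nontrivial_root_of_unity:
  fixes p q :: nat and c :: int
  assumes p: "prime p" and q: "prime q" and root: "[c ^ p = 1] (mod int q)"
    and nontriv: "\<not> [c = 1] (mod int q)"
  shows "p dvd q - 1"
proof -
  define r where "r = nat (c mod int q)"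
  have "q > 0" using q prime_gt_0_nat by blast
  then have rc: "[int r = c] (mod int q)" by (simp add: r_def cong_def)
  have "[int r ^ p = 1] (mod int q)" using cong_trans[OF cong_pow[OF rc] root] .
  then have rp: "[r ^ p = 1] (mod q)" by (metis cong_int_iff of_nat_1 of_nat_power)
  then have "ord q r dvd p" by (simp add: ord_divides')
  moreover have "ord q r \<noteq> 1"
  proof
    assume "ord q r = 1"
    then have "[r = 1] (mod q)" using ord[of r q] by simp
    then have "[int r = 1] (mod int q)" by (metis cong_int_iff of_nat_1)
    then show False using nontriv rc cong_trans cong_sym by blast
  qed
  ultimately have "ord q r = p" using p by (auto simp: prime_nat_iff)
  moreover have "\<not> q dvd r"
  proof
    assume "q dvd r"
    then have "[r ^ p = 0] (mod q)"
      using p dvd_trans[OF _ dvd_power, of q r p] by (simp add: cong_0_iff prime_gt_0_nat)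
    then have "[1 = 0] (mod q)" using rp cong_trans cong_sym by blast
    then show False using q by (simp add: cong_0_iff)
  qed
  then have "[r ^ (q - 1) = 1] (mod q)" using q by (rule fermat_theorem[rotated])
  ultimately show ?thesis by (simp add: ord_divides')
qed

text \<open>
  Modulo \<open>p\<close> the prime \<open>q\<close> is \<open>1\<close>, hence a square, and the sign in the reciprocity law is
  positive because \<open>(p - 1) / 2\<close> is even.
\<close>

lemma QuadRes_of_cong_1_mod:
  fixes p q :: nat
  assumes p: "prime p" "[p = 1] (mod 4)" and q: "prime q" "q > 2" and dvd: "p dvd q - 1"
  shows "QuadRes (int q) (int p)"
proof -
  have "p > 2"
    using p prime_ge_2_nat[of p] by (cases "p = 2") (auto simp: cong_def)
  moreover have "p \<noteq> q"
    using dvd q dvd_imp_le[of p "q - 1"] by auto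
  moreover have "even ((p - 1) div 2)"
    using p(2) by (auto simp: cong_def elim!: evenE) presburger
  ultimately have eq: "Legendre (int p) (int q) * Legendre (int q) (int p) = 1"
    using Quadratic_Reciprocity[of p q] p q by simp
  have "[q = 1] (mod p)"
    using dvd q cong_altdef_nat[of 1 q p] by auto
  then have "[1\<^sup>2 = int q] (mod int p)"
    by (metis cong_int_iff cong_sym of_nat_1 one_power2)
  then have "QuadRes (int p) (int q)" unfolding QuadRes_def by blast
  then have "Legendre (int q) (int p) \<noteq> -1" by (simp add: Legendre_def)
  then have "Legendre (int p) (int q) \<noteq> -1" using eq by (auto simp: minus_equation_iff)
  moreover have "Legendre (int p) (int q) \<noteq> 0" using eq by auto
  ultimately show ?thesis by (auto simp: Legendre_def split: if_splits)
qed

text \<open>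
  The two square roots modulo \<open>q\<close>, \<open>w\<close> of \<open>c = - p * y\<^sup>2\<close> and \<open>z\<close> of \<open>p\<close>, give
  \<open>w\<^sup>2 + (z * y)\<^sup>2 \<equiv> c + p * y\<^sup>2 = 0\<close>, which is the input to Thue's argument.
\<close>

lemma prime_dvd_cofactor_imp_sum_of_two_squares:
  fixes p q :: nat and y :: int
  defines "c \<equiv> - (int p * y\<^sup>2)"
  assumes p: "prime p" "[p = 1] (mod 4)" and q: "prime q" and dvd: "int q dvd (\<Sum>i<p. c ^ i)"
  shows "sum_of_two_squares (int q)"
proof (cases "q = 2")
  case True
  then show ?thesis by (intro sum_of_two_squaresI[of _ 1 1]) simp
next
  case False
  then have q2: "q > 2" using prime_ge_2_nat[OF q] by linarith
  have pq: "prime (int q)" using q by simp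
  have p0: "p > 0" using p prime_gt_0_nat by blast
  have "c ^ p - 1 = (c - 1) * (\<Sum>i<p. c ^ i)" by (rule power_diff_1_eq)
  then have root: "[c ^ p = 1] (mod int q)" using dvd by (simp add: cong_iff_dvd_diff)
  have ndvd: "\<not> int q dvd c"
  proof
    assume "int q dvd c"
    then have "[c ^ p = 0] (mod int q)"
      using p0 dvd_trans[OF _ dvd_power, of "int q" c p] by (simp add: cong_0_iff)
    then have "[1 = 0] (mod int q)" using root cong_trans cong_sym by blast
    then show False using q by (simp add: cong_0_iff)
  qed
  have "\<not> [c = 1] (mod int q)"
  proof
    assume "[c = 1] (mod int q)"
    then have "[(\<Sum>i<p. c ^ i) = (\<Sum>i<p. 1 ^ i)] (mod int q)"
      by (intro cong_sum cong_pow)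
    then have "int q dvd int p" using dvd by (simp add: cong_dvd_iff)
    \<comment> \<open>This forces \<open>q = p\<close>, which divides \<open>c\<close>.\<close>
    then have "int q dvd c" by (simp add: c_def)
    then show False using ndvd by contradiction
  qed
  then have "p dvd q - 1"
    using prime_dvd_pred_of_nontrivial_root_of_unity[OF p(1) q root] by blast
  then obtain z where z: "[z\<^sup>2 = int p] (mod int q)"
    using QuadRes_of_cong_1_mod[OF p q q2] unfolding QuadRes_def by blast
  \<comment> \<open>An element of odd order \<open>p\<close> is the square of its power with exponent \<open>(p + 1) / 2\<close>.\<close>
  define w where "w = c ^ ((p + 1) div 2)"
  have "odd p" using p(2) by (auto simp: cong_def elim!: evenE) presburger
  then have "(p + 1) div 2 * 2 = Suc p" by presburger
  then have "w\<^sup>2 = c ^ p * c"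
    unfolding w_def power_mult[symmetric] by (simp only: power_Suc2)
  then have "[w\<^sup>2 = c] (mod int q)" using cong_mult[OF root cong_refl[of c]] by simp
  then have "[w\<^sup>2 + z\<^sup>2 * y\<^sup>2 = c + int p * y\<^sup>2] (mod int q)"
    using z by (intro cong_add cong_mult) auto
  then have sum: "int q dvd w\<^sup>2 + (z * y)\<^sup>2"
    by (simp add: c_def cong_0_iff power_mult_distrib)
  have "\<not> int q dvd z * y"
  proof
    assume "int q dvd z * y"
    then have "int q dvd z\<^sup>2 * y\<^sup>2" by (metis dvd_mult2 power2_eq_square power_mult_distrib)
    moreover have "[z\<^sup>2 * y\<^sup>2 = int p * y\<^sup>2] (mod int q)" using z by (intro cong_mult) auto
    ultimately have "int q dvd int p * y\<^sup>2" using cong_dvd_iff by blast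
    then show False using ndvd by (simp add: c_def)
  qed
  then show ?thesis using sum_of_two_squares_prime_dvd[OF q sum] by blast
qed

theorem theorem1p8:
  fixes n p :: nat and x a :: int
  assumes "odd n" and "n > 0"
    and "prime p" and "[p = 1] (mod 4)"
    and "x > 0"
    and "a = int p * x\<^sup>2"
  shows "sum_of_two_squares (a ^ n + 1) \<longleftrightarrow> sum_of_two_squares (a ^ (n * p) + 1)"
proof -
  obtain k where k: "n = 2 * k + 1" using \<open>odd n\<close> by (elim oddE)
  define y where "y = int p ^ k * x ^ n"
  define b where "b = a ^ n"
  define Q where "Q = (\<Sum>i<p. (- b) ^ i)"
  have b: "b = int p * y\<^sup>2"
    by (simp add: b_def y_def assms(6) k power_mult_distrib power_add power_mult
        algebra_simps power2_eq_square)
  have "odd p" using \<open>[p = 1] (mod 4)\<close> by (auto simp: cong_def elim!: evenE) presburger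
  then have "(b + 1) * Q = b ^ p + 1"
    using power_diff_1_eq[of "- b" p] by (simp add: Q_def algebra_simps)
  then have prod: "a ^ (n * p) + 1 = Q * (a ^ n + 1)"
    by (simp add: b_def power_mult mult.commute)
  have "a ^ (n * p) + 1 > 0" "a ^ n + 1 > 0"
    using assms(5,6) by (simp_all add: add_nonneg_pos)
  then have "Q > 0" using prod by (metis zero_less_mult_pos2)
  then obtain N :: nat where N: "Q = int N" "N > 0"
    by (metis zero_less_imp_eq_int)
  have "sum_of_two_squares (int q)" if "prime q" "q dvd N" for q
  proof (rule prime_dvd_cofactor_imp_sum_of_two_squares[OF assms(3,4) that(1)])
    have "int q dvd Q" using that(2) N by simp
    then show "int q dvd (\<Sum>i<p. (- (int p * y\<^sup>2)) ^ i)" by (simp add: Q_def b)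
  qed
  then have "sum_of_two_squares (int N * (a ^ n + 1)) \<longleftrightarrow> sum_of_two_squares (a ^ n + 1)"
    using N by (intro sum_of_two_squares_mult_iff)
  then show ?thesis using prod N by simp
qed

end
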